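(* Let $q_1,q_2\in\mathbb{C}$ and $\beta\in\mathbb{C}^\times$. Then for all $g,h\in(\mathbb{C}^\times)^3$, $$[[R^{\mathrm{cf}}_{q_1,q_2;\beta}(g),\,R^{\mathrm{cf}}_{q_1,q_2;\beta}(gh),\,R^{\mathrm{cf}}_{q_1,q_2;\beta}(h)]]=0,$$ and for all $g,h\in(\mathbb{C}^\times)^3$, $$[[R^{\mathrm{ff}}_{q_1,q_2;\beta}(g),\,R^{\mathrm{ff}}_{q_1,q_2;\beta}(gh),\,R^{\mathrm{ff}}_{q_1,q_2;\beta}(h)]]=0,$$ where $gh$ is the componentwise product in the group $(\mathbb{C}^\times)^3$.
   Context: Let $V=\mathbb{C}^2$ with standard basis $e_1,e_2$. Identify $4\times4$ complex matrices with operators in $\mathrm{End}(V\otimes V)$ using the ordered basis $e_1\otimes e_1,\ e_1\otimes e_2,\ e_2\otimes e_1,\ e_2\otimes e_2$. For $u,w,v\in\mathrm{End}(V\otimes V)$ define the Yang-Baxter commutator, an operator on $V\otimes V\otimes V$, by $$[[u,w,v]]=(u\otimes 1)(1\otimes w)(v\otimes 1)-(1\otimes v)(w\otimes 1)(1\otimes u).$$ For $q_1,q_2\in\mathbb{C}$, $\beta\in\mathbb{C}^\times$ and $(z_1,z_2;w)\in(\mathbb{C}^\times)^3$ define $$R^{\mathrm{cf}}_{q_1,q_2;\beta}(z_1,z_2;w)=\begin{pmatrix} q_1z_1-q_2z_2&0&0&0\\ 0&z_1(q_1-q_2)w&q_1(z_1-z_2)\beta&0\\ 0&q_2(z_1-z_2)\beta^{-1}&z_2(q_1-q_2)w^{-1}&0\\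 0&0&0&q_1z_1-q_2z_2\end{pmatrix},$$ $$R^{\mathrm{ff}}_{q_1,q_2;\beta}(z_1,z_2;w)=\begin{pmatrix} q_1z_1-q_2z_2&0&0&0\\ 0&z_1(q_1-q_2)w&q_1(z_1-z_2)\beta&0\\ 0&q_2(z_1-z_2)\beta^{-1}&z_2(q_1-q_2)w^{-1}&0\\ 0&0&0&q_1z_2-q_2z_1\end{pmatrix}.$$ *)

theory Defs
  imports Complex_Main "Jordan_Normal_Form.Matrix"
begin

text \<open>Operators on \<open>V \<otimes> V\<close> and \<open>V \<otimes> V \<otimes> V\<close>, for \<open>V = \<complex>\<^sup>2\<close>, are complex \<open>4 \<times> 4\<close> and
  \<open>8 \<times> 8\<close> matrices with respect to the lexicographically ordered bases
  \<open>e\<^sub>i \<otimes> e\<^sub>j\<close> and \<open>e\<^sub>i \<otimes> e\<^sub>j \<otimes> e\<^sub>k\<close>, acting on column vectors. Counting from 0, the basis vector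
  \<open>a \<otimes> b\<close> built from the \<open>i\<close>-th basis vector of the first factor and the \<open>j\<close>-th of the second factor,
  which has dimension \<open>d\<close>, has position \<open>i * d + j\<close>; so the tensor product of
  operators is the Kronecker product of matrices.\<close>

definition kronecker :: "complex mat \<Rightarrow> complex mat \<Rightarrow> complex mat" (infixl "\<otimes>\<^sub>K" 72) where
  "A \<otimes>\<^sub>K B = mat (dim_row A * dim_row B) (dim_col A * dim_col B)
     (\<lambda>(i, j). A $$ (i div dim_row B, j div dim_col B) * B $$ (i mod dim_row B, j mod dim_col B))"

text \<open>Only meaningful for \<open>u, w, v \<in> carrier_mat 4 4\<close>; \<open>1\<^sub>m 2\<close> is the identity of \<open>V\<close>.\<close>

definition yb_commutator :: "complex mat \<Rightarrow> complex mat \<Rightarrow> complex mat \<Rightarrow> complex mat" where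
  "yb_commutator u w v =
     (u \<otimes>\<^sub>K 1\<^sub>m 2) * (1\<^sub>m 2 \<otimes>\<^sub>K w) * (v \<otimes>\<^sub>K 1\<^sub>m 2) - (1\<^sub>m 2 \<otimes>\<^sub>K v) * (w \<otimes>\<^sub>K 1\<^sub>m 2) * (1\<^sub>m 2 \<otimes>\<^sub>K u)"

text \<open>The group \<open>(\<complex>\<^sup>\<times>)\<^sup>3\<close>; the triple \<open>(z1, z2, w)\<close> stands for the point \<open>(z\<^sub>1, z\<^sub>2; w)\<close>.\<close>

definition Cstar3 :: "(complex \<times> complex \<times> complex) set" where
  "Cstar3 = (- {0}) \<times> (- {0}) \<times> (- {0})"

fun mult3 :: "complex \<times> complex \<times> complex \<Rightarrow> complex \<times> complex \<times> complex
    \<Rightarrow> complex \<times> complex \<times> complex" where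
  "mult3 (z1, z2, w) (z1', z2', w') = (z1 * z1', z2 * z2', w * w')"

fun R_cf :: "complex \<Rightarrow> complex \<Rightarrow> complex \<Rightarrow> complex \<times> complex \<times> complex \<Rightarrow> complex mat" where
  "R_cf q1 q2 \<beta> (z1, z2, w) = mat_of_rows_list 4
     [[q1 * z1 - q2 * z2, 0, 0, 0],
      [0, z1 * (q1 - q2) * w, q1 * (z1 - z2) * \<beta>, 0],
      [0, q2 * (z1 - z2) * inverse \<beta>, z2 * (q1 - q2) * inverse w, 0],
      [0, 0, 0, q1 * z1 - q2 * z2]]"

fun R_ff :: "complex \<Rightarrow> complex \<Rightarrow> complex \<Rightarrow> complex \<times> complex \<times> complex \<Rightarrow> complex mat" where
  "R_ff q1 q2 \<beta> (z1, z2, w) = mat_of_rows_list 4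
     [[q1 * z1 - q2 * z2, 0, 0, 0],
      [0, z1 * (q1 - q2) * w, q1 * (z1 - z2) * \<beta>, 0],
      [0, q2 * (z1 - z2) * inverse \<beta>, z2 * (q1 - q2) * inverse w, 0],
      [0, 0, 0, q1 * z2 - q2 * z1]]"

end

theory Submission
  imports Defs
begin

text \<open>
  All the matrices in question are six-vertex matrices: they preserve the weight of a tensor, so
  their only non-zero entries are two diagonal weights \<open>a\<^sub>1, a\<^sub>2\<close> for \<open>e\<^sub>1 \<otimes> e\<^sub>1\<close> and \<open>e\<^sub>2 \<otimes> e\<^sub>2\<close>, and
  a block on the span of \<open>e\<^sub>1 \<otimes> e\<^sub>2\<close> and \<open>e\<^sub>2 \<otimes> e\<^sub>1\<close>. For three such matrices, the entries of the
  Yang-Baxter commutator amount to a system of thirteen equations in the weights (the star-triangle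
  relations). The decisive feature is that no equation contains both an \<open>a\<^sub>1\<close> and an \<open>a\<^sub>2\<close>: six
  equations mention only \<open>a\<^sub>1\<close>, the six obtained by exchanging \<open>e\<^sub>1\<close> and \<open>e\<^sub>2\<close> mention only \<open>a\<^sub>2\<close>,
  and one mentions only the diagonal weights of the block
  (lemma \<open>yb_commutator_six_vertex_eq_0\<close>). So \<open>a\<^sub>1\<close> and \<open>a\<^sub>2\<close> may be chosen independently of each
  other.

  For the block at hand, with entries \<open>p\<^sub>1 (z\<^sub>1 - z\<^sub>2)\<close>, \<open>p\<^sub>2 (z\<^sub>1 - z\<^sub>2)\<close>, \<open>z\<^sub>1 s w\<close> and \<open>z\<^sub>2 s / w\<close>, a
  weight \<open>a = \<xi> z\<^sub>1 + \<eta> z\<^sub>2\<close> satisfies its six equations as soon as \<open>\<xi> + \<eta> = s\<close> and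
  \<open>\<xi> \<eta> = - p\<^sub>1 p\<^sub>2\<close> (lemma \<open>half_star_triangle_linear_weight\<close>). Here \<open>s = q\<^sub>1 - q\<^sub>2\<close> and
  \<open>p\<^sub>1 p\<^sub>2 = q\<^sub>1 q\<^sub>2\<close>, so \<open>\<xi>\<close> and \<open>\<eta>\<close> are the numbers \<open>q\<^sub>1\<close> and \<open>- q\<^sub>2\<close> in one of the two orders.
  The two orders give \<open>q\<^sub>1 z\<^sub>1 - q\<^sub>2 z\<^sub>2\<close> and \<open>q\<^sub>1 z\<^sub>2 - q\<^sub>2 z\<^sub>1\<close>: the same order for \<open>a\<^sub>1\<close> and \<open>a\<^sub>2\<close> gives
  \<open>R\<^sup>c\<^sup>f\<close>, opposite orders give \<open>R\<^sup>f\<^sup>f\<close>.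
\<close>

section \<open>The star-triangle relations for six-vertex matrices\<close>

definition six_vertex ::
  "complex \<Rightarrow> complex \<Rightarrow> complex \<Rightarrow> complex \<Rightarrow> complex \<Rightarrow> complex \<Rightarrow> complex mat" where
  "six_vertex a1 a2 b1 b2 c1 c2 = mat_of_rows_list 4
     [[a1, 0, 0, 0],
      [0, c1, b1, 0],
      [0, b2, c2, 0],
      [0, 0, 0, a2]]"

text \<open>The arguments are the weights of the first, second and third matrix in the commutator. The
  remaining relations for \<open>a\<^sub>2\<close> are these same relations after exchanging \<open>e\<^sub>1\<close> and \<open>e\<^sub>2\<close>, which
  swaps \<open>b1\<close> with \<open>b2\<close> and \<open>c1\<close> with \<open>c2\<close> in each argument.\<close>

fun half_star_triangle ::
  "complex \<times> complex \<times> complex \<times> complex \<times> complex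
   \<Rightarrow> complex \<times> complex \<times> complex \<times> complex \<times> complex
   \<Rightarrow> complex \<times> complex \<times> complex \<times> complex \<times> complex \<Rightarrow> bool" where
  "half_star_triangle (a, b1, b2, c1, c2) (a', b1', b2', c1', c2') (a'', b1'', b2'', c1'', c2'') \<longleftrightarrow>
     a * a'' * c1' = a' * c1 * c1'' + b2 * b1'' * c1' \<and>
     a * a'' * c2' = a' * c2 * c2'' + b2 * b1'' * c2' \<and>
     a * b1' * c1'' = a' * b1 * c1'' + c2 * c1' * b1'' \<and>
     a'' * b2' * c1 = a' * b2'' * c1 + b2 * c1' * c2'' \<and>
     a * b1' * c2'' = a' * b1 * c2'' + c1 * c2' * b1'' \<and>
     a'' * b2' * c2 = a' * b2'' * c2 + b2 * c2' * c1''"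

lemma six_vertex_kronecker_one:
  "six_vertex a1 a2 b1 b2 c1 c2 \<otimes>\<^sub>K 1\<^sub>m 2 = mat_of_rows_list 8
     [[a1, 0, 0, 0, 0, 0, 0, 0],
      [0, a1, 0, 0, 0, 0, 0, 0],
      [0, 0, c1, 0, b1, 0, 0, 0],
      [0, 0, 0, c1, 0, b1, 0, 0],
      [0, 0, b2, 0, c2, 0, 0, 0],
      [0, 0, 0, b2, 0, c2, 0, 0],
      [0, 0, 0, 0, 0, 0, a2, 0],
      [0, 0, 0, 0, 0, 0, 0, a2]]" (is "?L = ?R")
proof (rule eq_matI)
  fix i j assume "i < dim_row ?R" "j < dim_col ?R"
  then have "i \<in> {0, 1, 2, 3, 4, 5, 6, 7}" "j \<in> {0, 1, 2, 3, 4, 5, 6, 7}"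
    by (auto simp: mat_of_rows_list_def)
  then show "?L $$ (i, j) = ?R $$ (i, j)"
    by (auto simp: kronecker_def six_vertex_def mat_of_rows_list_def)
qed (auto simp: kronecker_def six_vertex_def mat_of_rows_list_def)

lemma one_kronecker_six_vertex:
  "1\<^sub>m 2 \<otimes>\<^sub>K six_vertex a1 a2 b1 b2 c1 c2 = mat_of_rows_list 8
     [[a1, 0, 0, 0, 0, 0, 0, 0],
      [0, c1, b1, 0, 0, 0, 0, 0],
      [0, b2, c2, 0, 0, 0, 0, 0],
      [0, 0, 0, a2, 0, 0, 0, 0],
      [0, 0, 0, 0, a1, 0, 0, 0],
      [0, 0, 0, 0, 0, c1, b1, 0],
      [0, 0, 0, 0, 0, b2, c2, 0],
      [0, 0, 0, 0, 0, 0, 0, a2]]" (is "?L = ?R")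
proof (rule eq_matI)
  fix i j assume "i < dim_row ?R" "j < dim_col ?R"
  then have "i \<in> {0, 1, 2, 3, 4, 5, 6, 7}" "j \<in> {0, 1, 2, 3, 4, 5, 6, 7}"
    by (auto simp: mat_of_rows_list_def)
  then show "?L $$ (i, j) = ?R $$ (i, j)"
    by (auto simp: kronecker_def six_vertex_def mat_of_rows_list_def)
qed (auto simp: kronecker_def six_vertex_def mat_of_rows_list_def)

text \<open>Multiplying matrices given by their rows, one row of the product at a time, lets the simplifier
  compute a product of concrete matrices as a list of rows, without a separate evaluation of a sum
  for each pair of indices.\<close>

fun row_combination :: "nat \<Rightarrow> ('a :: semiring_0) list \<Rightarrow> 'a list list \<Rightarrow> 'a list" where
  "row_combination n (x # xs) (r # rs) = map2 (\<lambda>a b. x * a + b) r (row_combination n xs rs)"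
| "row_combination n _ _ = replicate n 0"

lemma length_row_combination [simp]:
  "(\<And>r. r \<in> set B \<Longrightarrow> length r = n) \<Longrightarrow> length (row_combination n xs B) = n"
  by (induction n xs B rule: row_combination.induct) auto

lemma nth_row_combination:
  assumes "\<And>r. r \<in> set B \<Longrightarrow> length r = n" "length xs = length B" "j < n"
  shows "row_combination n xs B ! j = (\<Sum>k<length B. xs ! k * B ! k ! j)"
  using assms
  by (induction n xs B rule: row_combination.induct)
     (auto simp: sum.lessThan_Suc_shift simp del: sum.lessThan_Suc)

lemma mat_of_rows_list_mult:
  assumes "length B = m" "\<forall>r\<in>set A. length r = m" "\<forall>r\<in>set B. length r = n"
  shows "mat_of_rows_list m A * mat_of_rows_list n B
    = mat_of_rows_list n (map (\<lambda>xs. row_combination n xs B) A)"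
  using assms
  by (intro eq_matI)
     (auto simp: mat_of_rows_list_def scalar_prod_def nth_row_combination lessThan_atLeast0)

text \<open>Both triple products preserve the weight of a tensor, so only the twenty entries between basis
  vectors of the same weight can differ. Six of these agree by commutativity, and the other fourteen
  are the assumed relations, where \<open>c\<close> accounts for two of them.\<close>

lemma yb_commutator_six_vertex_eq_0:
  assumes half1: "half_star_triangle (a1, b1, b2, c1, c2) (a1', b1', b2', c1', c2')
      (a1'', b1'', b2'', c1'', c2'')"
    and half2: "half_star_triangle (a2, b2, b1, c2, c1) (a2', b2', b1', c2', c1')
      (a2'', b2'', b1'', c2'', c1'')"
    and c: "c1 * c2' * c1'' = c2 * c1' * c2''"
  shows "yb_commutator (six_vertex a1 a2 b1 b2 c1 c2) (six_vertex a1' a2' b1' b2' c1' c2')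
    (six_vertex a1'' a2'' b1'' b2'' c1'' c2'') = 0\<^sub>m 8 8"
proof -
  note eqs = half1[unfolded half_star_triangle.simps] half2[unfolded half_star_triangle.simps] c
  have replicate_8: "replicate 8 (0 :: complex) = [0, 0, 0, 0, 0, 0, 0, 0]"
    by (simp add: eval_nat_numeral)
  let ?u = "six_vertex a1 a2 b1 b2 c1 c2" and ?w = "six_vertex a1' a2' b1' b2' c1' c2'"
    and ?v = "six_vertex a1'' a2'' b1'' b2'' c1'' c2''"
  have products_eq: "(?u \<otimes>\<^sub>K 1\<^sub>m 2) * (1\<^sub>m 2 \<otimes>\<^sub>K ?w) * (?v \<otimes>\<^sub>K 1\<^sub>m 2)
    = (1\<^sub>m 2 \<otimes>\<^sub>K ?v) * (?w \<otimes>\<^sub>K 1\<^sub>m 2) * (1\<^sub>m 2 \<otimes>\<^sub>K ?u)"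
    unfolding six_vertex_kronecker_one one_kronecker_six_vertex
  proof (simp add: mat_of_rows_list_mult replicate_8,
      rule arg_cong[of _ _ "mat_of_rows_list 8"], simp, intro conjI)
    \<comment> \<open>The goals are the relations up to the order of factors and summands; using the relations as
      rewrite rules could loop, so they are only normalised alongside the goals.\<close>
  qed ((insert eqs; elim conjE; simp (no_asm_use) only: mult_ac add_ac)+)
  have "(1\<^sub>m 2 \<otimes>\<^sub>K ?v) * (?w \<otimes>\<^sub>K 1\<^sub>m 2) * (1\<^sub>m 2 \<otimes>\<^sub>K ?u) \<in> carrier_mat 8 8"
    by (intro mult_carrier_mat[of _ 8 8] carrier_matI)
      (simp_all add: kronecker_def six_vertex_def mat_of_rows_list_def)
  then show ?thesis
    unfolding yb_commutator_def products_eq by (rule minus_r_inv_mat)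
qed

section \<open>Weights that are linear in the spectral parameters\<close>

text \<open>The first two relations are quadratic in \<open>a\<close>; they are multiples of
  \<open>a(z) a(y) = s a(z y) + b\<^sub>2(z) b\<^sub>1(y)\<close>, by \<open>c\<^sub>1'\<close> and \<open>c\<^sub>2'\<close>. This equation determines the product \<open>\<xi> \<eta>\<close>,
  since \<open>a(z) a(y) - (\<xi> + \<eta>) a(z y) = - \<xi> \<eta> (z\<^sub>1 - z\<^sub>2) (y\<^sub>1 - y\<^sub>2)\<close>. The other four relations are linear in \<open>a\<close> and depend only on the sum \<open>\<xi> + \<eta>\<close>.
  The parameters \<open>w\<close> and \<open>w'\<close> cancel because \<open>c\<^sub>1\<close> and \<open>c\<^sub>2\<close> carry them as mutually inverse
  characters of the group.\<close>

lemma half_star_triangle_linear_weight: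
  fixes \<xi> \<eta> s p1 p2 z1 z2 y1 y2 w w' :: complex
  assumes "\<xi> + \<eta> = s" "\<xi> * \<eta> = - (p1 * p2)" "w \<noteq> 0" "w' \<noteq> 0"
  shows "half_star_triangle
    (\<xi> * z1 + \<eta> * z2, p1 * (z1 - z2), p2 * (z1 - z2), z1 * s * w, z2 * s * inverse w)
    (\<xi> * (z1 * y1) + \<eta> * (z2 * y2), p1 * (z1 * y1 - z2 * y2), p2 * (z1 * y1 - z2 * y2),
     z1 * y1 * s * (w * w'), z2 * y2 * s * inverse (w * w'))
    (\<xi> * y1 + \<eta> * y2, p1 * (y1 - y2), p2 * (y1 - y2), y1 * s * w', y2 * s * inverse w')"
proof -
  have quadratic: "(\<xi> * z1 + \<eta> * z2) * (\<xi> * y1 + \<eta> * y2)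
      = (\<xi> * (z1 * y1) + \<eta> * (z2 * y2)) * s + p1 * p2 * (z1 - z2) * (y1 - y2)"
  proof -
    have "(\<xi> * z1 + \<eta> * z2) * (\<xi> * y1 + \<eta> * y2)
        = (\<xi> * (z1 * y1) + \<eta> * (z2 * y2)) * (\<xi> + \<eta>) - \<xi> * \<eta> * (z1 - z2) * (y1 - y2)"
      by (simp add: algebra_simps)
    then show ?thesis using assms(1,2) by simp
  qed
  show ?thesis
    unfolding half_star_triangle.simps quadratic
  proof (intro conjI, goal_cases)
    case 1 show ?case by (simp add: algebra_simps)
  next
    case 2 show ?case using assms(3,4) by (simp add: algebra_simps)
  next
    \<comment> \<open>In each linear relation, the \<open>w\<close>-dependent factors of the product of two \<open>c\<close>-weights have to
      cancel first; what is left is a polynomial identity.\<close>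
    case 3
    have "z2 * s * inverse w * (z1 * y1 * s * (w * w')) = z1 * z2 * y1 * s\<^sup>2 * w'"
      using assms(3) by (simp add: power2_eq_square)
    then show ?case
      by (simp only:) (simp add: assms(1)[symmetric] algebra_simps power2_eq_square)
  next
    case 4
    have "p2 * (z1 - z2) * (z1 * y1 * s * (w * w')) * (y2 * s * inverse w')
        = p2 * (z1 - z2) * (z1 * y1 * y2 * s\<^sup>2 * w)"
      using assms(4) by (simp add: power2_eq_square)
    then show ?case
      by (simp only:) (simp add: assms(1)[symmetric] algebra_simps power2_eq_square)
  next
    case 5
    have "z1 * s * w * (z2 * y2 * s * inverse (w * w')) = z1 * z2 * y2 * s\<^sup>2 * inverse w'"
      using assms(3) by (simp add: power2_eq_square)
    then show ?case
      by (simp only:) (simp add: assms(1)[symmetric] algebra_simps power2_eq_square)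
  next
    case 6
    have "p2 * (z1 - z2) * (z2 * y2 * s * inverse (w * w')) * (y1 * s * w')
        = p2 * (z1 - z2) * (z2 * y1 * y2 * s\<^sup>2 * inverse w)"
      using assms(4) by (simp add: power2_eq_square)
    then show ?case
      by (simp only:) (simp add: assms(1)[symmetric] algebra_simps power2_eq_square)
  qed
qed

text \<open>The common generalisation of \<open>R\<^sup>c\<^sup>f\<close> and \<open>R\<^sup>f\<^sup>f\<close> in which \<open>a\<^sub>1\<close> and \<open>a\<^sub>2\<close> are independent linear
  forms in \<open>z\<^sub>1\<close> and \<open>z\<^sub>2\<close>.\<close>

fun linear_R :: "complex \<Rightarrow> complex \<Rightarrow> complex \<Rightarrow> complex \<Rightarrow> complex \<Rightarrow> complex \<Rightarrow> complex
    \<Rightarrow> complex \<times> complex \<times> complex \<Rightarrow> complex mat" where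
  "linear_R s p1 p2 \<xi>1 \<eta>1 \<xi>2 \<eta>2 (z1, z2, w) =
     six_vertex (\<xi>1 * z1 + \<eta>1 * z2) (\<xi>2 * z1 + \<eta>2 * z2)
       (p1 * (z1 - z2)) (p2 * (z1 - z2)) (z1 * s * w) (z2 * s * inverse w)"

lemma yb_commutator_linear_R:
  assumes "\<xi>1 + \<eta>1 = s" "\<xi>1 * \<eta>1 = - (p1 * p2)"
    and "\<xi>2 + \<eta>2 = s" "\<xi>2 * \<eta>2 = - (p1 * p2)"
    and "g \<in> Cstar3" "h \<in> Cstar3"
  defines "R \<equiv> linear_R s p1 p2 \<xi>1 \<eta>1 \<xi>2 \<eta>2"
  shows "yb_commutator (R g) (R (mult3 g h)) (R h) = 0\<^sub>m 8 8"
proof -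
  obtain z1 z2 w y1 y2 w' where gh: "g = (z1, z2, w)" "h = (y1, y2, w')"
    by (metis prod_cases3)
  have w: "w \<noteq> 0" "w' \<noteq> 0"
    using assms(5,6) by (simp_all add: gh Cstar3_def)
  have half1: "half_star_triangle
    (\<xi>1 * z1 + \<eta>1 * z2, p1 * (z1 - z2), p2 * (z1 - z2), z1 * s * w, z2 * s * inverse w)
    (\<xi>1 * (z1 * y1) + \<eta>1 * (z2 * y2), p1 * (z1 * y1 - z2 * y2), p2 * (z1 * y1 - z2 * y2),
     z1 * y1 * s * (w * w'), z2 * y2 * s * inverse (w * w'))
    (\<xi>1 * y1 + \<eta>1 * y2, p1 * (y1 - y2), p2 * (y1 - y2), y1 * s * w', y2 * s * inverse w')"
    using assms(1,2) w by (rule half_star_triangle_linear_weight)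
  \<comment> \<open>Exchanging \<open>e\<^sub>1\<close> and \<open>e\<^sub>2\<close> amounts to exchanging \<open>z\<^sub>1\<close> with \<open>z\<^sub>2\<close>, inverting \<open>w\<close> and replacing
    \<open>(p\<^sub>1, p\<^sub>2)\<close> by \<open>(- p\<^sub>2, - p\<^sub>1)\<close>, so the linear weight lemma also yields the relations for \<open>a\<^sub>2\<close>.\<close>
  have minus: "- p * (y - x) = p * (x - y)" for p x y :: complex
    by (simp add: algebra_simps)
  have half2: "half_star_triangle
    (\<xi>2 * z1 + \<eta>2 * z2, p2 * (z1 - z2), p1 * (z1 - z2), z2 * s * inverse w, z1 * s * w)
    (\<xi>2 * (z1 * y1) + \<eta>2 * (z2 * y2), p2 * (z1 * y1 - z2 * y2), p1 * (z1 * y1 - z2 * y2),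
     z2 * y2 * s * inverse (w * w'), z1 * y1 * s * (w * w'))
    (\<xi>2 * y1 + \<eta>2 * y2, p2 * (y1 - y2), p1 * (y1 - y2), y2 * s * inverse w', y1 * s * w')"
    using half_star_triangle_linear_weight[of \<eta>2 \<xi>2 s "- p2" "- p1" "inverse w" "inverse w'"
        z2 z1 y2 y1] assms(3,4) w
    unfolding minus
    by (simp only: add.commute[of "\<eta>2 * _"] add.commute[of \<eta>2] mult.commute[of \<eta>2 \<xi>2]
        mult.commute[of p2 p1] minus_mult_minus nonzero_imp_inverse_nonzero
        inverse_mult_distrib[symmetric] inverse_inverse_eq simp_thms)
  have "z1 * s * w * (z2 * y2 * s * inverse (w * w')) * (y1 * s * w')
      = z2 * s * inverse w * (z1 * y1 * s * (w * w')) * (y2 * s * inverse w')"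
    using w by (simp add: field_simps)
  with half1 half2 show ?thesis
    unfolding R_def gh mult3.simps linear_R.simps by (rule yb_commutator_six_vertex_eq_0)
qed

section \<open>The two families\<close>

lemma R_cf_eq_linear_R:
  "R_cf q1 q2 \<beta> = linear_R (q1 - q2) (q1 * \<beta>) (q2 * inverse \<beta>) q1 (- q2) q1 (- q2)"
  by (rule ext) (auto simp: six_vertex_def mult_ac)

lemma R_ff_eq_linear_R:
  "R_ff q1 q2 \<beta> = linear_R (q1 - q2) (q1 * \<beta>) (q2 * inverse \<beta>) q1 (- q2) (- q2) q1"
  by (rule ext) (auto simp: six_vertex_def mult_ac)

theorem proposition3p2:
  fixes q1 q2 \<beta> :: complex
  assumes "\<beta> \<noteq> 0"
  shows "(\<forall>g\<in>Cstar3. \<forall>h\<in>Cstar3.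
            yb_commutator (R_cf q1 q2 \<beta> g) (R_cf q1 q2 \<beta> (mult3 g h)) (R_cf q1 q2 \<beta> h) = 0\<^sub>m 8 8) \<and>
         (\<forall>g\<in>Cstar3. \<forall>h\<in>Cstar3.
            yb_commutator (R_ff q1 q2 \<beta> g) (R_ff q1 q2 \<beta> (mult3 g h)) (R_ff q1 q2 \<beta> h) = 0\<^sub>m 8 8)"
  unfolding R_cf_eq_linear_R R_ff_eq_linear_R
  using assms by (intro conjI ballI; intro yb_commutator_linear_R) simp_all

end
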